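(* For every $\lambda>0$, $\overline{\psi(M,N,\lambda)}\cap\mathcal{B}\mathcal{C}_D(M,N)\subseteq\psi(M,N,\lambda)$, where the closure is taken in $\mathcal{B}(\mathcal{H},\mathcal{K})$ with respect to the operator norm.
   Context: $\mathcal{H}$ and $\mathcal{K}$ are real or complex Hilbert spaces, $\mathcal{B}(\mathcal{H},\mathcal{K})$ is the space of bounded linear operators from $\mathcal{H}$ to $\mathcal{K}$. $\mathcal{R}(\cdot)$ denotes range and $*$ denotes adjoint. $M\subseteq\mathcal{H}$ and $N\subseteq\mathcal{K}$ are closed subspaces. Block matrices $T=\begin{pmatrix}A&B\\C&D\end{pmatrix}$ are taken with respect to $\mathcal{H}=M\oplus M^\perp$ and $\mathcal{K}=N\oplus N^\perp$, so $A:M\to N$, $B:M^\perp\to N$, $C:M\to N^\perp$, $D:M^\perp\to N^\perp$. For a closed subspace $L$, $\mathcal{B}_L=\{x\in L:\|x\|\le1\}$. For $\lambda>0$, $\psi(M,N,\lambda)$ is the set of $(M,N,\lambda)$-complementable operators, i.e. those $T\in\mathcal{B}(\mathcal{H},\mathcal{K})$ with $C(\mathcal{B}_M)\subseteq\lambda D(\mathcal{B}_{M^\perp})$ and $B^*(\mathcal{B}_N)\subseteq\lambda D^*(\mathcal{B}_{N^\perp})$. $\mathcal{B}\mathcal{C}_D(M,N)$ is the set of $T\in\mathcal{B}(\mathcal{H},\mathcal{K})$ whose block $D$ has closed range $\mathcal{R}(D)$. *)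

theory Defs
  imports "HOL-Analysis.Analysis"
begin

text \<open>
  Scalars are a field with a multiplicative real norm and a conjugation.  The axioms fix the
  conjugation uniquely, and the lemma \<open>real_or_complex_cases\<close> below shows that \<open>real\<close> and
  \<open>complex\<close> are, up to isomorphism, the only instances.
\<close>

class real_or_complex = real_normed_field +
  fixes conjugation :: "'a \<Rightarrow> 'a"
  assumes conjugation_add: "conjugation (x + y) = conjugation x + conjugation y"
    and mult_conjugation_scaleR: "x * conjugation x = (norm x)\<^sup>2 *\<^sub>R 1"

lemma mult_conjugation: "(x::'k::real_or_complex) * conjugation x = of_real ((norm x)\<^sup>2)"
  by (simp only: mult_conjugation_scaleR of_real_def)

instantiation real :: real_or_complex
begin
definition conjugation_real :: "real \<Rightarrow> real" where "conjugation_real x = x"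
instance
  by standard (simp_all add: conjugation_real_def power2_eq_square)
end

instantiation complex :: real_or_complex
begin
definition conjugation_complex :: "complex \<Rightarrow> complex" where "conjugation_complex = cnj"
instance
  by standard (simp_all add: conjugation_complex_def complex_norm_square scaleR_conv_of_real
      flip: of_real_power)
end

lemma real_or_complex_sqrt_neg:
  fixes z :: "'k::real_or_complex"
  shows "\<exists>a b. (z - of_real a)\<^sup>2 = - ((of_real b)\<^sup>2)"
proof -
  let ?c = "conjugation z"
  have one: "conjugation (1::'k) = 1"
    using mult_conjugation[of "1::'k"] by simp
  have "(1 + z) * conjugation (1 + z) = of_real ((norm (1 + z))\<^sup>2)"
    by (rule mult_conjugation)
  hence "z + ?c = of_real ((norm (1 + z))\<^sup>2 - 1 - (norm z)\<^sup>2)"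
    using mult_conjugation[of z] by (simp add: conjugation_add one algebra_simps)
  then obtain t where t: "z + ?c = of_real (2 * t)"
    by (metis field_sum_of_halves mult_2 mult.commute)
  let ?n = "(norm z)\<^sup>2"
  have "z * (of_real (2 * t) - z) = of_real ?n"
    using mult_conjugation[of z] t by (metis add_diff_cancel_left')
  hence sq: "(z - of_real t)\<^sup>2 = of_real (t\<^sup>2 - ?n)"
    by (simp add: power2_eq_square algebra_simps)
  show ?thesis
  proof (cases "t\<^sup>2 \<le> ?n")
    case True
    have "(of_real (sqrt (?n - t\<^sup>2)) :: 'k)\<^sup>2 = of_real (?n - t\<^sup>2)"
      using True by (metis of_real_power real_sqrt_pow2 diff_ge_0_iff_ge)
    hence "(z - of_real t)\<^sup>2 = - ((of_real (sqrt (?n - t\<^sup>2)))\<^sup>2)"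
      using sq by simp
    thus ?thesis by blast
  next
    case False
    define s where "s = sqrt (t\<^sup>2 - ?n)"
    have "(of_real s :: 'k)\<^sup>2 = of_real (t\<^sup>2 - ?n)"
      using False unfolding s_def by (metis of_real_power real_sqrt_pow2 diff_ge_0_iff_ge linear)
    hence "(z - of_real t)\<^sup>2 = (of_real s)\<^sup>2"
      using sq by simp
    hence "z - of_real t = of_real s \<or> z - of_real t = - of_real s"
      by (simp add: power2_eq_iff)
    hence "z = of_real (t + s) \<or> z = of_real (t - s)"
      by (auto simp: algebra_simps)
    then obtain r where "z = of_real r" by blast
    hence "(z - of_real r)\<^sup>2 = - ((of_real 0)\<^sup>2)" by simp
    thus ?thesis by blast
  qed
qed

lemma real_or_complex_cases:
  "(\<forall>z::'k::real_or_complex. z \<in> \<real>) \<or>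
   (\<exists>i::'k. i\<^sup>2 = -1 \<and> (\<forall>z. \<exists>a b. z = of_real a + of_real b * i))"
proof (cases "\<forall>z::'k. z \<in> \<real>")
  case False
  then obtain w :: 'k where w: "w \<notin> \<real>" by blast
  obtain a b where ab: "(w - of_real a)\<^sup>2 = - ((of_real b)\<^sup>2)"
    using real_or_complex_sqrt_neg by blast
  have b: "b \<noteq> 0"
    using ab w by auto
  define i where "i = (w - of_real a) / of_real b"
  have i: "i\<^sup>2 = -1"
    using b by (simp add: i_def power_divide ab)
  have "\<exists>a b. z = of_real a + of_real b * i" for z
  proof -
    obtain c d where "(z - of_real c)\<^sup>2 = - ((of_real d)\<^sup>2)"
      using real_or_complex_sqrt_neg by blast
    hence "(z - of_real c)\<^sup>2 = (of_real d * i)\<^sup>2"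
      by (simp add: power_mult_distrib i)
    hence "z - of_real c = of_real d * i \<or> z - of_real c = of_real (- d) * i"
      by (simp add: power2_eq_iff)
    thus ?thesis by (metis add.commute diff_add_cancel)
  qed
  with i show ?thesis by blast
qed simp

text \<open>
  A Hilbert space over \<open>'k\<close> with inner product \<open>ip\<close>, linear in the first argument; its norm,
  real scalar multiplication and completeness are those of the type \<open>'a\<close>.  Positive definiteness
  of \<open>ip\<close> follows from \<open>ip_self\<close>.
\<close>

locale hilbert_space = vector_space scl
  for scl :: "'k::real_or_complex \<Rightarrow> 'a::{real_normed_vector, complete_space} \<Rightarrow> 'a" +
  fixes ip :: "'a \<Rightarrow> 'a \<Rightarrow> 'k"
  assumes scl_of_real: "scl (of_real r) x = r *\<^sub>R x"
    and ip_add_left: "ip (x + y) z = ip x z + ip y z"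
    and ip_scl_left: "ip (scl c x) y = c * ip x y"
    and ip_commute: "ip y x = conjugation (ip x y)"
    and ip_self: "ip x x = of_real ((norm x)\<^sup>2)"

lemma hilbert_space_real:
  "hilbert_space (scaleR :: real \<Rightarrow> 'a::{real_inner, complete_space} \<Rightarrow> 'a) inner"
  by unfold_locales
    (simp_all add: algebra_simps conjugation_real_def inner_commute power2_norm_eq_inner)

lemma hilbert_space_complex:
  "hilbert_space (times :: complex \<Rightarrow> complex \<Rightarrow> complex) (\<lambda>x y. x * cnj y)"
  by unfold_locales
    (simp_all add: algebra_simps conjugation_complex_def scaleR_conv_of_real
      complex_norm_square del: of_real_power)

definition bounded_ops ::
  "('k \<Rightarrow> 'a \<Rightarrow> 'a) \<Rightarrow> ('k \<Rightarrow> 'b \<Rightarrow> 'b) \<Rightarrow> ('a::real_normed_vector \<Rightarrow>\<^sub>L 'b::real_normed_vector) set"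
  where "bounded_ops sclH sclK = {T. \<forall>c x. blinfun_apply T (sclH c x) = sclK c (blinfun_apply T x)}"

definition orth_compl :: "('a \<Rightarrow> 'a \<Rightarrow> 'k::zero) \<Rightarrow> 'a set \<Rightarrow> 'a set"
  where "orth_compl ip L = {x. \<forall>y\<in>L. ip x y = 0}"

text \<open>For a closed subspace \<open>L\<close> the described vector exists uniquely (projection theorem).\<close>

definition orth_proj :: "('a::ab_group_add \<Rightarrow> 'a \<Rightarrow> 'k::zero) \<Rightarrow> 'a set \<Rightarrow> 'a \<Rightarrow> 'a"
  where "orth_proj ip L x = (THE p. p \<in> L \<and> x - p \<in> orth_compl ip L)"

definition block ::
  "('b \<Rightarrow> 'b \<Rightarrow> 'k::zero) \<Rightarrow> 'a set \<Rightarrow> 'b set \<Rightarrow>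
    ('a::real_normed_vector \<Rightarrow>\<^sub>L 'b::real_normed_vector) \<Rightarrow> 'a \<Rightarrow> 'b"
  where "block ipK U V T = (\<lambda>x\<in>U. orth_proj ipK V (blinfun_apply T x))"

text \<open>
  The adjoint of an operator \<open>S\<close> with domain the closed subspace \<open>U\<close>; for bounded linear \<open>S\<close>
  the described vector exists uniquely (Riesz).
\<close>

definition adjoint_on ::
  "('a \<Rightarrow> 'a \<Rightarrow> 'k) \<Rightarrow> ('b \<Rightarrow> 'b \<Rightarrow> 'k) \<Rightarrow> 'a set \<Rightarrow> ('a \<Rightarrow> 'b) \<Rightarrow> 'b \<Rightarrow> 'a"
  where "adjoint_on ipH ipK U S y = (THE x. x \<in> U \<and> (\<forall>u\<in>U. ipK (S u) y = ipH u x))"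

definition unit_ball :: "'a::real_normed_vector set \<Rightarrow> 'a set"
  where "unit_ball L = {x \<in> L. norm x \<le> 1}"

definition complementable ::
  "('k \<Rightarrow> 'a \<Rightarrow> 'a) \<Rightarrow> ('a \<Rightarrow> 'a \<Rightarrow> 'k::zero) \<Rightarrow> ('k \<Rightarrow> 'b \<Rightarrow> 'b) \<Rightarrow> ('b \<Rightarrow> 'b \<Rightarrow> 'k) \<Rightarrow>
    'a set \<Rightarrow> 'b set \<Rightarrow> real \<Rightarrow> ('a::real_normed_vector \<Rightarrow>\<^sub>L 'b::real_normed_vector) set"
  where "complementable sclH ipH sclK ipK M N lam =
    {T \<in> bounded_ops sclH sclK.
      (let M' = orth_compl ipH M; N' = orth_compl ipK N;
           B = block ipK M' N T; C = block ipK M N' T; D = block ipK M' N' T;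
           Badj = adjoint_on ipH ipK M' B; Dadj = adjoint_on ipH ipK M' D
       in C ` unit_ball M \<subseteq> scaleR lam ` D ` unit_ball M' \<and>
          Badj ` unit_ball N \<subseteq> scaleR lam ` Dadj ` unit_ball N')}"

definition closed_range_D ::
  "('k \<Rightarrow> 'a \<Rightarrow> 'a) \<Rightarrow> ('a \<Rightarrow> 'a \<Rightarrow> 'k::zero) \<Rightarrow> ('k \<Rightarrow> 'b \<Rightarrow> 'b) \<Rightarrow> ('b \<Rightarrow> 'b \<Rightarrow> 'k) \<Rightarrow>
    'a set \<Rightarrow> 'b set \<Rightarrow> ('a::real_normed_vector \<Rightarrow>\<^sub>L 'b::real_normed_vector) set"
  where "closed_range_D sclH ipH sclK ipK M N =
    {T \<in> bounded_ops sclH sclK.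
      closed (block ipK (orth_compl ipH M) (orth_compl ipK N) T ` orth_compl ipH M)}"

end

theory Submission
  imports Defs
begin

text \<open>
  In a Hilbert space a decreasing sequence of nonempty bounded closed convex sets has a common
  point (almost minimal vectors form a Cauchy sequence, by the parallelogram law).  Hence a bounded
  operator maps bounded closed convex sets onto closed sets, and an inclusion
  \<open>G(\<B>\<^sub>U) \<subseteq> \<lambda> G(\<B>\<^sub>V)\<close> passes to norm limits of \<open>G\<close>.  Both complementability
  conditions have this form: with \<open>G = P T\<close>, where \<open>P\<close> is the projection onto \<open>N\<^sup>\<bottom>\<close>, and with
  \<open>G\<close> the adjoint of the restriction of \<open>T\<close> to \<open>M\<^sup>\<bottom>\<close>; both depend continuously on \<open>T\<close>.
\<close>

section \<open>Conjugation on the scalar field, and unit balls\<close>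

lemma conjugation_zero: "conjugation (0::'k::real_or_complex) = 0"
  using conjugation_add[of "0::'k" 0] by simp

text \<open>The axiom on \<open>x * conjugation x\<close> determines conjugation away from 0.
  Multiplicativity, preservation of the norm and involutivity then become field arithmetic, with no
  split into the real and the complex case.\<close>

lemma conjugation_eq_divide: "x \<noteq> 0 \<Longrightarrow> conjugation (x::'k::real_or_complex) = of_real ((norm x)\<^sup>2) / x"
  using mult_conjugation[of x] by (simp add: field_simps)

lemma conjugation_mult: "conjugation (x * y) = conjugation x * conjugation (y::'k::real_or_complex)"
  by (cases "x = 0 \<or> y = 0")
    (auto simp: conjugation_zero conjugation_eq_divide norm_mult power_mult_distrib)

lemma norm_conjugation: "norm (conjugation x) = norm (x::'k::real_or_complex)"
  by (cases "x = 0")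
    (auto simp: conjugation_zero conjugation_eq_divide norm_divide norm_mult power2_eq_square)

lemma conjugation_conjugation: "conjugation (conjugation x) = (x::'k::real_or_complex)"
proof (cases "x = 0")
  case False
  then have "conjugation x \<noteq> 0"
    by (metis norm_conjugation norm_eq_zero)
  then show ?thesis
    using False
    by (subst conjugation_eq_divide) (simp_all add: norm_conjugation, simp add: conjugation_eq_divide)
qed (simp add: conjugation_zero)

lemma conjugation_of_real: "conjugation (of_real r) = (of_real r::'k::real_or_complex)"
  by (cases "r = 0") (auto simp: conjugation_zero conjugation_eq_divide power2_eq_square)

lemma closed_unit_ball: "closed V \<Longrightarrow> closed (unit_ball V)"
  and bounded_unit_ball: "bounded (unit_ball V)"
  and convex_unit_ball: "convex V \<Longrightarrow> convex (unit_ball V)"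
proof -
  have eq: "unit_ball V = V \<inter> cball 0 1"
    by (auto simp: unit_ball_def)
  show "closed V \<Longrightarrow> closed (unit_ball V)" "bounded (unit_ball V)"
    "convex V \<Longrightarrow> convex (unit_ball V)"
    by (auto simp: eq bounded_Int intro: convex_Int)
qed

section \<open>Inner product identities and the Cauchy-Schwarz inequality\<close>

context hilbert_space
begin

lemma ip_add_right: "ip x (y + z) = ip x y + ip x z"
  by (metis ip_commute ip_add_left conjugation_add)

lemma ip_scl_right: "ip x (scl c y) = conjugation c * ip x y"
  by (metis ip_commute ip_scl_left conjugation_mult)

lemma ip_zero_left: "ip 0 x = 0"
  using ip_add_left[of 0 0 x] by simp

lemma ip_zero_right: "ip x 0 = 0"
  using ip_add_right[of x 0 0] by simp

lemma ip_minus_left: "ip (- x) y = - ip x y"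
  using ip_add_left[of x "- x" y] by (simp add: ip_zero_left eq_neg_iff_add_eq_0 add.commute)

lemma ip_minus_right: "ip x (- y) = - ip x y"
  using ip_add_right[of x y "- y"] by (simp add: ip_zero_right eq_neg_iff_add_eq_0 add.commute)

lemma ip_diff_left: "ip (x - y) z = ip x z - ip y z"
  using ip_add_left[of x "- y" z] by (simp add: ip_minus_left)

lemma ip_diff_right: "ip x (y - z) = ip x y - ip x z"
  using ip_add_right[of x y "- z"] by (simp add: ip_minus_right)

lemmas ip_simps = ip_add_left ip_add_right ip_diff_left ip_diff_right ip_scl_left ip_scl_right

lemma ip_self_eq_0: "ip x x = 0 \<Longrightarrow> x = 0"
  by (simp add: ip_self)

lemma ip_eq_0_commute: "ip x y = 0 \<longleftrightarrow> ip y x = 0"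
  by (metis ip_commute conjugation_zero)

lemma parallelogram_law:
  fixes x y :: 'a
  shows "(norm (x - y))\<^sup>2 + (norm (x + y))\<^sup>2 = 2 * (norm x)\<^sup>2 + 2 * (norm y)\<^sup>2"
proof -
  \<comment> \<open>Inner products live in \<open>'k\<close>, so the real identity is checked there
    and pulled back along the injective \<open>of_real\<close>.\<close>
  have "(of_real ((norm (x - y))\<^sup>2 + (norm (x + y))\<^sup>2) :: 'k)
      = of_real (2 * (norm x)\<^sup>2 + 2 * (norm y)\<^sup>2)"
    by (simp add: ip_self[symmetric] ip_simps del: of_real_power)
  then show ?thesis
    by (simp only: of_real_eq_iff)
qed

lemma pythagoras:
  assumes "ip x y = 0"
  shows "(norm (x + y))\<^sup>2 = (norm x)\<^sup>2 + (norm y)\<^sup>2"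
proof -
  have "ip y x = 0"
    using assms ip_eq_0_commute by simp
  then have "(of_real ((norm (x + y))\<^sup>2) :: 'k) = of_real ((norm x)\<^sup>2 + (norm y)\<^sup>2)"
    using assms by (simp add: ip_self[symmetric] ip_simps del: of_real_power)
  then show ?thesis
    by (simp only: of_real_eq_iff)
qed

lemma norm_scl: "norm (scl c x) = norm c * norm x"
proof -
  have "(of_real ((norm (scl c x))\<^sup>2) :: 'k) = (c * conjugation c) * ip x x"
    by (simp only: ip_self[symmetric] ip_simps mult_ac)
  also have "\<dots> = of_real ((norm c)\<^sup>2 * (norm x)\<^sup>2)"
    by (simp add: mult_conjugation ip_self)
  finally have "(norm (scl c x))\<^sup>2 = (norm c * norm x)\<^sup>2"
    by (simp only: of_real_eq_iff power_mult_distrib)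
  then show ?thesis
    by simp
qed

text \<open>Subtracting from \<open>z\<close> its component along \<open>y\<close>; yields both Cauchy-Schwarz and the
  orthogonality of the residual of a nearest point.\<close>

lemma norm_residual:
  assumes "y \<noteq> 0"
  shows "(norm (z - scl (ip z y / of_real ((norm y)\<^sup>2)) y))\<^sup>2
    = (norm z)\<^sup>2 - (norm (ip z y))\<^sup>2 / (norm y)\<^sup>2"
proof -
  let ?c = "ip z y / of_real ((norm y)\<^sup>2)"
  let ?w = "z - scl ?c y"
  have "ip ?w y = 0"
    using assms by (simp add: ip_simps ip_self)
  then have "ip ?w (scl ?c y) = 0"
    by (simp add: ip_scl_right)
  from pythagoras[OF this] have "(norm z)\<^sup>2 = (norm ?w)\<^sup>2 + (norm (scl ?c y))\<^sup>2"
    by simp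
  moreover have "(norm (scl ?c y))\<^sup>2 = (norm (ip z y))\<^sup>2 / (norm y)\<^sup>2"
    using assms by (simp add: norm_scl norm_divide norm_mult power2_eq_square)
  ultimately show ?thesis
    by linarith
qed

lemma Cauchy_Schwarz: "norm (ip x y) \<le> norm x * norm y"
proof (cases "y = 0")
  case False
  have "0 \<le> (norm x)\<^sup>2 - (norm (ip x y))\<^sup>2 / (norm y)\<^sup>2"
    unfolding norm_residual[OF False, of x, symmetric] by (rule zero_le_power2)
  then have "(norm (ip x y))\<^sup>2 \<le> (norm x * norm y)\<^sup>2"
    using False by (simp add: field_simps)
  then show ?thesis
    by (rule power2_le_imp_le) simp
qed (simp add: ip_zero_right)

section \<open>Nested convex sets, as a substitute for weak compactness\<close>

lemma nested_convex_Inter_nonempty: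
  fixes F :: "nat \<Rightarrow> 'a set"
  assumes "\<And>n. closed (F n)" "\<And>n. convex (F n)" "\<And>n. F n \<noteq> {}"
    and "decseq F" and "bounded (F 0)"
  shows "(\<Inter>n. F n) \<noteq> {}"
proof -
  \<comment> \<open>The infimum of the squared norm over \<open>F n\<close> grows as the sets shrink
    and stays below \<open>b^2\<close>, hence it converges.\<close>
  define d where "d n = (INF x\<in>F n. (norm x)\<^sup>2)" for n
  have bdd: "bdd_below ((\<lambda>x. (norm x)\<^sup>2) ` F n)" for n
    by (rule bdd_belowI2[of _ 0]) simp
  have d_le: "d n \<le> (norm x)\<^sup>2" if "x \<in> F n" for n x
    unfolding d_def using bdd that by (rule cINF_lower)
  obtain b where b: "\<And>x. x \<in> F 0 \<Longrightarrow> norm x \<le> b"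
    using \<open>bounded (F 0)\<close> by (auto simp: bounded_iff)
  have "incseq d"
    unfolding d_def
    by (intro monoI cINF_superset_mono bdd assms) (use \<open>decseq F\<close> in \<open>auto simp: decseq_def\<close>)
  moreover have "d n \<le> b\<^sup>2" for n
  proof -
    obtain x where "x \<in> F n"
      using assms(3) by blast
    moreover from this have "norm x \<le> b"
      using b \<open>decseq F\<close> by (auto simp: decseq_def)
    ultimately show ?thesis
      using d_le by (meson norm_ge_zero order_trans power_mono)
  qed
  ultimately obtain l where l: "d \<longlonglongrightarrow> l" "\<And>n. d n \<le> l"
    using incseq_convergent by metis
  have "\<exists>x\<in>F n. (norm x)\<^sup>2 < d n + 1 / Suc n" for n
    using cINF_less_iff[OF assms(3) bdd, of n "d n + 1 / Suc n"] by (auto simp: d_def)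
  then obtain u where u: "\<And>n. u n \<in> F n" "\<And>n. (norm (u n))\<^sup>2 < d n + 1 / Suc n"
    by metis
  \<comment> \<open>For \<open>m <= n\<close>, the parallelogram law bounds the squared distance by
    \<open>2 * (d n + 1 / Suc n) + 2 * (d m + 1 / Suc m) - 4 * d m\<close>; replacing
    \<open>d n\<close> by \<open>l\<close> and \<open>1 / Suc n\<close> by \<open>1 / Suc m\<close>
    gives \<open>r m\<close>.\<close>
  define r where "r m = 2 * (l - d m) + 4 * (1 / real (Suc m))" for m
  have close: "(norm (u n - u m))\<^sup>2 \<le> r m" if "m \<le> n" for m n
  proof -
    have "u n \<in> F m"
      using that u(1) \<open>decseq F\<close> by (auto simp: decseq_def)
    \<comment> \<open>Convexity enters here: the midpoint stays in \<open>F m\<close>, so its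
      squared norm is at least \<open>d m\<close>.\<close>
    then have "(1/2) *\<^sub>R u n + (1/2) *\<^sub>R u m \<in> F m"
      using u(1) by (intro convexD assms(2)) auto
    then have "d m \<le> (norm ((1/2) *\<^sub>R (u n + u m)))\<^sup>2"
      by (intro d_le) (simp add: scaleR_add_right)
    then have "4 * d m \<le> (norm (u n + u m))\<^sup>2"
      by (simp add: power_divide)
    moreover have "1 / real (Suc n) \<le> 1 / real (Suc m)"
      using that by (simp add: field_simps)
    ultimately show ?thesis
      using parallelogram_law[of "u n" "u m"] u(2)[of n] u(2)[of m] l(2)[of n]
      unfolding r_def by argo
  qed
  have "r \<longlonglongrightarrow> 2 * (l - l) + 4 * 0"
    unfolding r_def
    by (intro tendsto_intros l LIMSEQ_Suc[OF lim_1_over_n] LIMSEQ_Suc[OF lim_1_over_n])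
  then have r0: "r \<longlonglongrightarrow> 0"
    by simp
  have "Cauchy u"
  proof (rule CauchyI')
    fix e :: real
    assume "e > 0"
    then have "eventually (\<lambda>m. r m < e\<^sup>2) sequentially"
      using r0 by (intro order_tendstoD) auto
    then obtain k where "\<And>m. m \<ge> k \<Longrightarrow> r m < e\<^sup>2"
      by (auto simp: eventually_sequentially)
    then have "norm (u n - u m) < e" if "m \<ge> k" "n > m" for m n
      using close[of m n] that \<open>e > 0\<close>
      by (meson le_less_trans less_imp_le power_less_imp_less_base)
    then show "\<exists>M. \<forall>m\<ge>M. \<forall>n>m. dist (u m) (u n) < e"
      by (metis dist_norm norm_minus_commute)
  qed
  then obtain x where x: "u \<longlonglongrightarrow> x"
    using Cauchy_convergent convergent_def by blast
  have "x \<in> F n" for n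
  proof (rule Lim_in_closed_set[OF assms(1) _ _ x])
    show "eventually (\<lambda>k. u k \<in> F n) sequentially"
      using u(1) \<open>decseq F\<close> unfolding eventually_sequentially decseq_def by blast
  qed simp
  then show ?thesis
    by blast
qed

text \<open>For \<open>y\<close> in the closure of the image, the points of \<open>S\<close> sent
  into ever smaller closed balls about \<open>y\<close> form a nested sequence of the kind treated
  above. A common point is sent to \<open>y\<close> itself.\<close>

lemma closed_image_bounded_convex:
  fixes G :: "'a \<Rightarrow> 'c::real_normed_vector"
  assumes "closed S" "convex S" "bounded S" "bounded_linear G"
  shows "closed (G ` S)"
proof (rule closure_subset_eq[THEN iffD1], rule subsetI)
  fix y
  assume y: "y \<in> closure (G ` S)"
  interpret G: bounded_linear G
    by fact
  define F where "F n = S \<inter> G -` cball y (1 / real (Suc n))" for n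
  have "(\<Inter>n. F n) \<noteq> {}"
  proof (rule nested_convex_Inter_nonempty)
    fix n
    show "closed (F n)"
      unfolding F_def
      by (rule closed_Int[OF assms(1) closed_vimage[OF closed_cball linear_continuous_on[OF assms(4)]]])
    show "convex (F n)"
      unfolding F_def
      by (rule convex_Int[OF assms(2) convex_linear_vimage[OF G.linear_axioms convex_cball]])
    show "F n \<noteq> {}"
    proof -
      have "\<exists>z\<in>G ` S. dist z y < 1 / real (Suc n)"
        using y unfolding closure_approachable by (meson of_nat_0_less_iff zero_less_Suc zero_less_divide_1_iff)
      then obtain u where "u \<in> S" "dist (G u) y < 1 / real (Suc n)"
        by blast
      then show ?thesis
        unfolding F_def by (auto simp: dist_commute less_imp_le)
    qed
  next
    show "decseq F"
    proof (rule antimonoI)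
      fix m n :: nat
      assume "m \<le> n"
      then have "1 / real (Suc n) \<le> 1 / real (Suc m)"
        by (simp add: frac_le)
      then show "F n \<subseteq> F m"
        unfolding F_def by auto
    qed
    show "bounded (F 0)"
      unfolding F_def using \<open>bounded S\<close> by (simp add: bounded_Int)
  qed
  then obtain u where "u \<in> S" and le: "\<forall>n. dist y (G u) \<le> 1 / real (Suc n)"
    unfolding F_def by (auto simp del: of_nat_Suc)
  have "dist y (G u) \<le> 0"
    by (rule LIMSEQ_le_const[OF LIMSEQ_Suc[OF lim_1_over_n]]) (use le in auto)
  then show "y \<in> G ` S"
    using \<open>u \<in> S\<close> by simp
qed

section \<open>Orthogonal complements, projections and Riesz representation\<close>

lemma subspace_scaleR: "subspace L \<Longrightarrow> x \<in> L \<Longrightarrow> r *\<^sub>R x \<in> L"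
  by (metis scl_of_real subspace_scale)

lemma subspace_convex: "subspace L \<Longrightarrow> convex L"
  by (simp add: convexI subspace_add subspace_scaleR)

lemma subspace_orth_compl: "subspace (orth_compl ip L)"
  by (rule subspaceI) (auto simp: orth_compl_def ip_simps ip_zero_left)

lemma ip_scaleR_left: "ip (r *\<^sub>R x) y = of_real r * ip x y"
  by (metis scl_of_real ip_scl_left)

lemma continuous_ip_left: "continuous_on UNIV (\<lambda>x. ip x y)"
proof -
  have "bounded_linear (\<lambda>x. ip x y)"
    by (rule bounded_linear_intro[where K = "norm y"])
      (simp_all only: ip_add_left Cauchy_Schwarz ip_scaleR_left scaleR_conv_of_real)
  then show ?thesis
    by (rule linear_continuous_on)
qed

lemma closed_orth_compl: "closed (orth_compl ip L)"
proof -
  have "orth_compl ip L = (\<Inter>y\<in>L. {x. ip x y = 0})"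
    by (auto simp: orth_compl_def)
  also have "closed \<dots>"
    by (intro closed_INT ballI closed_Collect_eq continuous_ip_left continuous_on_const)
  finally show ?thesis .
qed

lemma orth_proj_exists:
  assumes "closed L" "subspace L"
  shows "\<exists>p\<in>L. x - p \<in> orth_compl ip L"
proof -
  let ?d = "infdist x L"
  have ne: "L \<noteq> {}"
    using subspace_0 assms by blast
  \<comment> \<open>Near-minimizers of the distance from \<open>x\<close> to \<open>L\<close>: a
    point common to all these sets is a nearest point.\<close>
  define F where "F n = L \<inter> cball x (?d + 1 / real (Suc n))" for n
  have "(\<Inter>n. F n) \<noteq> {}"
  proof (rule nested_convex_Inter_nonempty)
    fix n
    show "closed (F n)"
      unfolding F_def by (rule closed_Int[OF assms(1) closed_cball])
    show "convex (F n)"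
      unfolding F_def by (rule convex_Int[OF subspace_convex[OF assms(2)] convex_cball])
    have "bdd_below (dist x ` L)"
      by (rule bdd_belowI2[of _ 0]) simp
    then have "\<exists>p\<in>L. dist x p < ?d + 1 / real (Suc n)"
      using cINF_less_iff[of L "dist x" "?d + 1 / real (Suc n)"] ne
      by (simp add: infdist_notempty)
    then obtain p where "p \<in> L" "dist x p < ?d + 1 / real (Suc n)"
      by blast
    then have "p \<in> F n"
      unfolding F_def by simp
    then show "F n \<noteq> {}"
      by blast
  next
    show "decseq F"
    proof (rule antimonoI)
      fix m n :: nat
      assume "m \<le> n"
      then have "1 / real (Suc n) \<le> 1 / real (Suc m)"
        by (simp add: frac_le)
      then show "F n \<subseteq> F m"
        unfolding F_def by auto
    qed
    show "bounded (F 0)"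
      unfolding F_def by (simp add: bounded_Int)
  qed
  then obtain p where "p \<in> L" and le: "\<forall>n. dist x p \<le> ?d + 1 / real (Suc n)"
    unfolding F_def by (auto simp del: of_nat_Suc)
  have "(\<lambda>n. ?d + 1 / real (Suc n)) \<longlonglongrightarrow> ?d + 0"
    by (intro tendsto_intros LIMSEQ_Suc[OF lim_1_over_n])
  then have nearest: "dist x p \<le> dist x q" if "q \<in> L" for q
    using LIMSEQ_le_const[of _ "?d + 0" "dist x p"] le infdist_le[OF that, of x] by force
  have "ip (x - p) y = 0" if "y \<in> L" for y
  proof (cases "y = 0")
    case False
    \<comment> \<open>Moving \<open>p\<close> by the component of \<open>x - p\<close> along
      \<open>y\<close> stays in \<open>L\<close> and, by \<open>norm_residual\<close>, lowers the
      squared distance by \<open>(norm (ip (x - p) y))^2 / (norm y)^2\<close>. As \<open>p\<close>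
      is nearest, this amount must vanish.\<close>
    let ?q = "p + scl (ip (x - p) y / of_real ((norm y)\<^sup>2)) y"
    have "?q \<in> L"
      using that \<open>p \<in> L\<close> assms by (intro subspace_add subspace_scale)
    then have "dist x p \<le> dist x ?q"
      by (rule nearest)
    then have "norm (x - p) \<le> norm (x - p - scl (ip (x - p) y / of_real ((norm y)\<^sup>2)) y)"
      by (simp only: dist_norm diff_diff_eq)
    from power_mono[OF this norm_ge_zero, of 2]
    have "(norm (ip (x - p) y))\<^sup>2 / (norm y)\<^sup>2 \<le> 0"
      unfolding norm_residual[OF False] by simp
    then show ?thesis
      using False by (simp add: divide_le_0_iff)
  qed (simp add: ip_zero_right)
  then show ?thesis
    using \<open>p \<in> L\<close> by (auto simp: orth_compl_def)
qed

lemma orth_compl_Int: "subspace L \<Longrightarrow> x \<in> L \<Longrightarrow> x \<in> orth_compl ip L \<Longrightarrow> x = 0"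
  by (auto simp: orth_compl_def intro: ip_self_eq_0)

text \<open>Two candidates differ by a vector lying both in \<open>L\<close> and in its complement,
  hence by 0. This resolves the \<open>THE\<close> in the definition and lets projections be
  identified by their defining property; linearity of \<open>orth_proj\<close> is obtained this
  way.\<close>

lemma orth_proj_eqI:
  assumes "subspace L" "p \<in> L" "x - p \<in> orth_compl ip L"
  shows "orth_proj ip L x = p"
  unfolding orth_proj_def
proof (rule the_equality)
  fix q
  assume q: "q \<in> L \<and> x - q \<in> orth_compl ip L"
  have "(x - p) - (x - q) \<in> orth_compl ip L"
    using q assms subspace_orth_compl by (blast intro: subspace_diff)
  then show "q = p"
    using orth_compl_Int[of L "q - p"] q assms by (simp add: subspace_diff)
qed (use assms in simp)

context
  fixes L
  assumes L: "closed L" "subspace L"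
begin

lemma orth_proj_mem: "orth_proj ip L x \<in> L"
  and orth_proj_diff: "x - orth_proj ip L x \<in> orth_compl ip L"
  using orth_proj_exists[OF L, of x] orth_proj_eqI[OF L(2)] by auto

lemma ip_orth_proj_left: "y \<in> L \<Longrightarrow> ip (orth_proj ip L x) y = ip x y"
  using orth_proj_diff[of x] by (simp add: orth_compl_def ip_diff_left)

lemma norm_orth_proj_le: "norm (orth_proj ip L x) \<le> norm x"
proof -
  have "ip (x - orth_proj ip L x) (orth_proj ip L x) = 0"
    using orth_proj_diff orth_proj_mem by (simp add: orth_compl_def)
  then have "(norm x)\<^sup>2 = (norm (x - orth_proj ip L x))\<^sup>2 + (norm (orth_proj ip L x))\<^sup>2"
    using pythagoras by fastforce
  then show ?thesis
    by (intro power2_le_imp_le[OF _ norm_ge_zero]) simp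
qed

lemma bounded_linear_orth_proj: "bounded_linear (orth_proj ip L)"
proof (rule bounded_linear_intro[where K = 1])
  fix x y r
  have "x + y - (orth_proj ip L x + orth_proj ip L y) \<in> orth_compl ip L"
    using subspace_add[OF subspace_orth_compl orth_proj_diff[of x] orth_proj_diff[of y]]
    by (simp add: algebra_simps)
  then show "orth_proj ip L (x + y) = orth_proj ip L x + orth_proj ip L y"
    using L by (intro orth_proj_eqI subspace_add orth_proj_mem)
  have "r *\<^sub>R x - r *\<^sub>R orth_proj ip L x \<in> orth_compl ip L"
    using subspace_scaleR[OF subspace_orth_compl orth_proj_diff[of x]]
    by (simp add: scaleR_diff_right)
  then show "orth_proj ip L (r *\<^sub>R x) = r *\<^sub>R orth_proj ip L x"
    using L by (intro orth_proj_eqI subspace_scaleR orth_proj_mem)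
qed (simp add: norm_orth_proj_le)

end

text \<open>The kernel of a nonzero \<open>f\<close> is a closed subspace. A vector \<open>v\<close>
  orthogonal to it with \<open>f v\<close> nonzero accounts for all of \<open>f\<close>, since
  \<open>x - scl (f x / f v) v\<close> lies in the kernel for every \<open>x\<close>.\<close>

lemma Riesz:
  assumes add: "\<And>x y. f (x + y) = f x + f y" and scl: "\<And>c x. f (scl c x) = c * f x"
    and bound: "\<And>x. norm (f x) \<le> norm x * K"
  shows "\<exists>z. \<forall>x. f x = ip x z"
proof (cases "\<forall>x. f x = 0")
  case True
  then show ?thesis
    by (intro exI[of _ 0]) (simp add: ip_zero_right)
next
  case False
  then obtain w where w: "f w \<noteq> 0"
    by blast
  have "f (r *\<^sub>R x) = r *\<^sub>R f x" for r x
    by (metis scl scl_of_real scaleR_conv_of_real)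
  then have f: "bounded_linear f"
    by (intro bounded_linear_intro[where K = K]) (simp_all add: add bound)
  interpret f: bounded_linear f by (rule f)
  let ?L = "{x. f x = 0}"
  have L: "closed ?L" "subspace ?L"
    by (auto intro!: closed_Collect_eq linear_continuous_on f subspaceI simp: f.zero add scl)
  define v where "v = w - orth_proj ip ?L w"
  have v: "v \<in> orth_compl ip ?L" "f v = f w"
    using orth_proj_diff[OF L, of w] orth_proj_mem[OF L, of w] by (auto simp: v_def f.diff)
  then have nz: "f v \<noteq> 0" "norm v \<noteq> 0"
    using w f.zero by auto
  \<comment> \<open>The factor is conjugated because \<open>ip\<close> is conjugate-linear in its
    second argument.\<close>
  define z where "z = scl (conjugation (f v) / of_real ((norm v)\<^sup>2)) v"
  have "f x = ip x z" for x
  proof -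
    have "x - scl (f x / f v) v \<in> ?L"
      using nz by (simp add: f.diff scl)
    then have "ip (x - scl (f x / f v) v) v = 0"
      using v ip_eq_0_commute unfolding orth_compl_def by blast
    then have "ip x v = (f x / f v) * of_real ((norm v)\<^sup>2)"
      by (simp add: ip_simps ip_self)
    \<comment> \<open>The inverse of \<open>(norm v)^2\<close> is real, hence fixed by
      conjugation.\<close>
    moreover have "conjugation (conjugation (f v) / of_real ((norm v)\<^sup>2))
        = f v / of_real ((norm v)\<^sup>2)"
      using conjugation_mult[of "conjugation (f v)" "of_real (inverse ((norm v)\<^sup>2))"]
      by (simp only: conjugation_conjugation conjugation_of_real divide_inverse flip: of_real_inverse)
    ultimately show ?thesis
      using nz by (simp add: z_def ip_scl_right)
  qed
  then show ?thesis
    by blast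
qed

lemma unit_ball_inclusion_limit:
  fixes G :: "'a \<Rightarrow> 'c::real_normed_vector"
  assumes G: "bounded_linear G" and V: "closed V" "subspace V" and "lam > 0"
    and approx: "\<And>e. e > 0 \<Longrightarrow> \<exists>H. (\<forall>x. norm (H x - G x) \<le> e * norm x) \<and>
      H ` unit_ball U \<subseteq> scaleR lam ` H ` unit_ball V"
  shows "G ` unit_ball U \<subseteq> scaleR lam ` G ` unit_ball V"
proof
  fix y
  assume "y \<in> G ` unit_ball U"
  then obtain x where x: "x \<in> unit_ball U" "y = G x"
    by blast
  have "y /\<^sub>R lam \<in> closure (G ` unit_ball V)"
    unfolding closure_approachable
  proof safe
    fix e :: real
    assume "e > 0"
    \<comment> \<open>The error below is at most \<open>k / lam + k = k * c\<close>;
      \<open>k\<close> is chosen to make this \<open>e / 2\<close>, which leaves room for a strict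
      inequality.\<close>
    define c where "c = 1 + 1 / lam"
    define k where "k = e / 2 / c"
    have "c > 0"
      using \<open>lam > 0\<close> by (simp add: c_def add_pos_pos)
    then have "k > 0"
      using \<open>e > 0\<close> by (simp add: k_def)
    then obtain H where H: "\<And>x. norm (H x - G x) \<le> k * norm x"
      and sub: "H ` unit_ball U \<subseteq> scaleR lam ` H ` unit_ball V"
      using approx by blast
    obtain u where u: "u \<in> unit_ball V" "H x = lam *\<^sub>R H u"
      using sub x by blast
    have le: "norm (H z - G z) \<le> k" if "norm z \<le> 1" for z
      using H[of z] that \<open>k > 0\<close> by (smt (verit) mult_left_le)
    \<comment> \<open>Since \<open>H x = lam *\<^sub>R H u\<close>, the two terms in
      \<open>H\<close> cancel.\<close>
    have "G u - y /\<^sub>R lam = (H x - G x) /\<^sub>R lam - (H u - G u)"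
      using \<open>lam > 0\<close> by (simp add: u x scaleR_diff_right)
    also have "norm \<dots> \<le> norm (H x - G x) / lam + norm (H u - G u)"
      using norm_triangle_ineq4[of "(H x - G x) /\<^sub>R lam" "H u - G u"] \<open>lam > 0\<close>
      by (simp add: divide_inverse mult.commute)
    also have "\<dots> \<le> k / lam + k"
      using le x(1) u(1) \<open>lam > 0\<close> by (intro add_mono divide_right_mono) (auto simp: unit_ball_def)
    also have "\<dots> = e / 2"
    proof -
      have "k / lam + k = k * c"
        by (simp add: c_def algebra_simps)
      also have "\<dots> = e / 2"
        using \<open>c > 0\<close> by (simp add: k_def)
      finally show ?thesis .
    qed
    finally show "\<exists>z\<in>G ` unit_ball V. dist z (y /\<^sub>R lam) < e"
      using u(1) \<open>e > 0\<close> by (intro bexI[of _ "G u"]) (auto simp: dist_norm)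
  qed
  moreover have "closed (G ` unit_ball V)"
    by (intro closed_image_bounded_convex G closed_unit_ball convex_unit_ball bounded_unit_ball
        V subspace_convex)
  ultimately obtain u where "u \<in> unit_ball V" "y /\<^sub>R lam = G u"
    by auto
  moreover from this have "y = lam *\<^sub>R G u"
    using \<open>lam > 0\<close> by (metis less_irrefl scaleR_scaleR right_inverse scaleR_one)
  ultimately show "y \<in> scaleR lam ` G ` unit_ball V"
    by blast
qed

end

section \<open>Adjoints on closed subspaces, and block operators\<close>

locale hilbert_space_pair = H: hilbert_space sclH ipH + K: hilbert_space sclK ipK
  for sclH :: "'k::real_or_complex \<Rightarrow> 'a::{real_normed_vector, complete_space} \<Rightarrow> 'a"
    and ipH :: "'a \<Rightarrow> 'a \<Rightarrow> 'k"
    and sclK :: "'k \<Rightarrow> 'b::{real_normed_vector, complete_space} \<Rightarrow> 'b"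
    and ipK :: "'b \<Rightarrow> 'b \<Rightarrow> 'k"
begin

context
  fixes U
  assumes U: "closed U" "H.subspace U"
begin

text \<open>If \<open>z\<close> and \<open>x\<close> both represent the functional on
  \<open>U\<close>, then \<open>z - x\<close> lies in \<open>U\<close> and is orthogonal to
  itself.\<close>

lemma adjoint_on_eqI:
  assumes "x \<in> U" "\<And>u. u \<in> U \<Longrightarrow> ipK (S u) y = ipH u x"
  shows "adjoint_on ipH ipK U S y = x"
  unfolding adjoint_on_def
proof (rule the_equality)
  fix z
  assume z: "z \<in> U \<and> (\<forall>u\<in>U. ipK (S u) y = ipH u z)"
  then have mem: "z - x \<in> U"
    using assms U by (blast intro: H.subspace_diff)
  then have "ipH (z - x) (z - x) = 0"
    using z assms(2)[OF mem] by (simp add: H.ip_diff_right)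
  then show "z = x"
    using H.ip_self_eq_0[of "z - x"] by simp
qed (use assms in simp)

text \<open>The functional is represented on the whole space first, and the representing vector is
  then projected onto \<open>U\<close>. Inner products with elements of \<open>U\<close> do not
  notice the projection, so Riesz is not applied to \<open>U\<close> as a space of its own.\<close>

lemma adjoint_on_exists:
  assumes "T \<in> bounded_ops sclH sclK"
  shows "\<exists>x\<in>U. \<forall>u\<in>U. ipK (blinfun_apply T u) y = ipH u x"
proof -
  have "\<exists>z. \<forall>u. ipK (blinfun_apply T u) y = ipH u z"
  proof (rule H.Riesz[where K = "norm T * norm y"])
    fix x
    show "norm (ipK (blinfun_apply T x) y) \<le> norm x * (norm T * norm y)"
      using K.Cauchy_Schwarz[of "blinfun_apply T x" y]
        mult_right_mono[OF norm_blinfun[of T x] norm_ge_zero[of y]]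
      by (simp add: mult_ac)
  qed (use assms in \<open>auto simp: bounded_ops_def blinfun.add_right K.ip_simps\<close>)
  then obtain z where z: "\<And>u. ipK (blinfun_apply T u) y = ipH u z"
    by blast
  have "ipH u (orth_proj ipH U z) = ipH u z" if "u \<in> U" for u
    using H.ip_orth_proj_left[OF U that, of z] H.ip_commute by metis
  then show ?thesis
    using z H.orth_proj_mem[OF U, of z] by metis
qed

lemma
  assumes "T \<in> bounded_ops sclH sclK"
  shows adjoint_on_mem: "adjoint_on ipH ipK U (blinfun_apply T) y \<in> U"
    and ip_adjoint_on: "u \<in> U \<Longrightarrow>
      ipH u (adjoint_on ipH ipK U (blinfun_apply T) y) = ipK (blinfun_apply T u) y"
  using adjoint_on_exists[OF assms, of y] adjoint_on_eqI by metis+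

text \<open>Together with \<open>norm_adjoint_on_le\<close> this makes the adjoint depend
  continuously on the operator.\<close>

lemma adjoint_on_diff:
  assumes "S \<in> bounded_ops sclH sclK" "T \<in> bounded_ops sclH sclK"
  shows "adjoint_on ipH ipK U (blinfun_apply (S - T)) y
    = adjoint_on ipH ipK U (blinfun_apply S) y - adjoint_on ipH ipK U (blinfun_apply T) y"
  using assms U
  by (intro adjoint_on_eqI H.subspace_diff adjoint_on_mem)
    (simp_all add: H.ip_diff_right ip_adjoint_on blinfun.diff_left K.ip_diff_left)

lemma norm_adjoint_on_le:
  assumes "T \<in> bounded_ops sclH sclK"
  shows "norm (adjoint_on ipH ipK U (blinfun_apply T) y) \<le> norm T * norm y"
proof -
  let ?x = "adjoint_on ipH ipK U (blinfun_apply T) y"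
  have "(norm ?x)\<^sup>2 = norm (ipH ?x ?x)"
    by (simp add: H.ip_self norm_power)
  \<comment> \<open>The defining identity is tested at \<open>u = ?x\<close>, which is allowed
    because the adjoint takes values in \<open>U\<close>.\<close>
  also have "\<dots> = norm (ipK (blinfun_apply T ?x) y)"
    using assms by (simp add: ip_adjoint_on adjoint_on_mem)
  also have "\<dots> \<le> norm (blinfun_apply T ?x) * norm y"
    by (rule K.Cauchy_Schwarz)
  also have "\<dots> \<le> (norm T * norm ?x) * norm y"
    by (intro mult_right_mono norm_blinfun) simp
  finally have "norm ?x * norm ?x \<le> norm ?x * (norm T * norm y)"
    by (simp add: power2_eq_square mult_ac)
  then show ?thesis
    by (cases "?x = 0") auto
qed

lemma bounded_linear_adjoint_on:
  assumes "T \<in> bounded_ops sclH sclK"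
  shows "bounded_linear (adjoint_on ipH ipK U (blinfun_apply T))"
proof (rule bounded_linear_intro[where K = "norm T"])
  fix x y r
  let ?A = "adjoint_on ipH ipK U (blinfun_apply T)"
  show "?A (x + y) = ?A x + ?A y"
    using assms U
    by (intro adjoint_on_eqI H.subspace_add adjoint_on_mem)
      (simp_all add: H.ip_add_right ip_adjoint_on K.ip_add_right)
  show "?A (r *\<^sub>R x) = r *\<^sub>R ?A x"
    using assms U
    by (intro adjoint_on_eqI H.subspace_scaleR adjoint_on_mem)
      (simp_all add: H.ip_scl_right ip_adjoint_on K.ip_scl_right
        flip: H.scl_of_real K.scl_of_real)
  show "norm (?A x) \<le> norm x * norm T"
    using norm_adjoint_on_le[OF assms, of x] by (simp add: mult.commute)
qed

text \<open>For \<open>y\<close> in \<open>V\<close> the projection onto \<open>V\<close> drops out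
  of the inner product with \<open>y\<close>. So the adjoints of the blocks \<open>B\<close> and
  \<open>D\<close> are the restrictions to \<open>N\<close> and its complement of one operator, the
  adjoint of \<open>T\<close> restricted to the complement of \<open>M\<close>.\<close>

lemma adjoint_on_block:
  assumes "T \<in> bounded_ops sclH sclK" "closed V" "K.subspace V" "y \<in> V"
  shows "adjoint_on ipH ipK U (block ipK U V T) y = adjoint_on ipH ipK U (blinfun_apply T) y"
  using assms
  by (intro adjoint_on_eqI adjoint_on_mem)
    (simp_all add: block_def K.ip_orth_proj_left ip_adjoint_on)

end

text \<open>Brings both conditions to the shape required by
  \<open>unit_ball_inclusion_limit\<close>, where a single operator acts on two unit balls:
  \<open>P\<close> replaces the pair \<open>C\<close>, \<open>D\<close>, and \<open>A\<close>
  replaces the pair of adjoints.\<close>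

lemma mem_complementable_iff:
  assumes M: "closed M" "H.subspace M" and N: "closed N" "K.subspace N"
    and T: "T \<in> bounded_ops sclH sclK"
  defines "M' \<equiv> orth_compl ipH M" and "N' \<equiv> orth_compl ipK N"
  defines "P \<equiv> (\<lambda>x. orth_proj ipK N' (blinfun_apply T x))"
    and "A \<equiv> adjoint_on ipH ipK M' (blinfun_apply T)"
  shows "T \<in> complementable sclH ipH sclK ipK M N lam \<longleftrightarrow>
    P ` unit_ball M \<subseteq> scaleR lam ` P ` unit_ball M' \<and>
    A ` unit_ball N \<subseteq> scaleR lam ` A ` unit_ball N'"
proof -
  have M': "closed M'" "H.subspace M'" and N': "closed N'" "K.subspace N'"
    by (auto simp: M'_def N'_def H.closed_orth_compl H.subspace_orth_compl
        K.closed_orth_compl K.subspace_orth_compl)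
  \<comment> \<open>Used with \<open>L\<close> equal to \<open>M\<close> for the block
    \<open>C\<close> and to \<open>M'\<close> for \<open>D\<close>; likewise \<open>adj\<close>
    below is used with \<open>N\<close> and \<open>N'\<close>.\<close>
  have block: "block ipK L N' T ` unit_ball L = P ` unit_ball L" for L
    by (rule image_cong) (auto simp: block_def P_def unit_ball_def)
  have adj: "adjoint_on ipH ipK M' (block ipK M' L T) ` unit_ball L = A ` unit_ball L"
    if "closed L" "K.subspace L" for L
    using that T by (intro image_cong) (auto simp: A_def unit_ball_def adjoint_on_block[OF M'])
  show ?thesis
    using T unfolding complementable_def Let_def
    by (simp add: block adj[OF N] adj[OF N'] flip: M'_def N'_def)
qed

section \<open>Passage to the norm limit in both conditions\<close>

lemma closure_complementable_subset:
  assumes M: "closed M" "H.subspace M" and N: "closed N" "K.subspace N" and "lam > 0"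
  shows "bounded_ops sclH sclK \<inter> closure (complementable sclH ipH sclK ipK M N lam)
    \<subseteq> complementable sclH ipH sclK ipK M N lam"
proof
  fix T
  assume "T \<in> bounded_ops sclH sclK \<inter> closure (complementable sclH ipH sclK ipK M N lam)"
  then have T: "T \<in> bounded_ops sclH sclK"
    and cl: "\<And>e. e > 0 \<Longrightarrow> \<exists>S\<in>complementable sclH ipH sclK ipK M N lam. dist S T < e"
    by (auto simp: closure_approachable)
  define M' N' where "M' = orth_compl ipH M" and "N' = orth_compl ipK N"
  have M': "closed M'" "H.subspace M'" and N': "closed N'" "K.subspace N'"
    by (auto simp: M'_def N'_def H.closed_orth_compl H.subspace_orth_compl
        K.closed_orth_compl K.subspace_orth_compl)
  interpret Q: bounded_linear "orth_proj ipK N'"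
    by (rule K.bounded_linear_orth_proj[OF N'])
  let ?P = "\<lambda>S x. orth_proj ipK N' (blinfun_apply S x)"
  let ?A = "\<lambda>S. adjoint_on ipH ipK M' (blinfun_apply S)"
  \<comment> \<open>An operator \<open>S\<close> within \<open>e\<close> of \<open>T\<close> serves
    for both conditions: projecting does not increase norms, and the adjoint of \<open>S - T\<close>
    has norm at most that of \<open>S - T\<close>.\<close>
  have approx: "\<exists>S\<in>bounded_ops sclH sclK.
      (\<forall>x. norm (?P S x - ?P T x) \<le> e * norm x) \<and> (\<forall>y. norm (?A S y - ?A T y) \<le> e * norm y) \<and>
      ?P S ` unit_ball M \<subseteq> scaleR lam ` ?P S ` unit_ball M' \<and>
      ?A S ` unit_ball N \<subseteq> scaleR lam ` ?A S ` unit_ball N'" if e_pos: "e > 0" for e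
  proof -
    obtain S where S: "S \<in> complementable sclH ipH sclK ipK M N lam" and "dist S T < e"
      using cl[OF e_pos] by blast
    then have e: "norm (S - T) \<le> e"
      by (simp add: dist_norm)
    have SB: "S \<in> bounded_ops sclH sclK"
      using S by (simp add: complementable_def)
    have "S - T \<in> bounded_ops sclH sclK"
      using SB T by (simp add: bounded_ops_def blinfun.diff_left K.scale_right_diff_distrib)
    then have A: "norm (?A S y - ?A T y) \<le> e * norm y" for y
      using norm_adjoint_on_le[OF M', of "S - T" y] mult_right_mono[OF e norm_ge_zero[of y]]
      by (simp add: adjoint_on_diff[OF M' SB T])
    have P: "norm (?P S x - ?P T x) \<le> e * norm x" for x
      using K.norm_orth_proj_le[OF N', of "blinfun_apply (S - T) x"] norm_blinfun[of "S - T" x]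
        mult_right_mono[OF e norm_ge_zero[of x]]
      by (simp add: blinfun.diff_left Q.diff)
    show ?thesis
      using mem_complementable_iff[OF M N SB] S A P SB by (auto simp: M'_def N'_def)
  qed
  have "?P T ` unit_ball M \<subseteq> scaleR lam ` ?P T ` unit_ball M'"
  proof (rule H.unit_ball_inclusion_limit[OF _ M' \<open>lam > 0\<close>])
    show "bounded_linear (?P T)"
      using bounded_linear_compose[OF Q.bounded_linear_axioms blinfun.bounded_linear_right[of T]] .
  qed (use approx in meson)
  moreover have "?A T ` unit_ball N \<subseteq> scaleR lam ` ?A T ` unit_ball N'"
    by (rule K.unit_ball_inclusion_limit[OF bounded_linear_adjoint_on[OF M' T] N' \<open>lam > 0\<close>])
      (use approx in meson)
  ultimately show "T \<in> complementable sclH ipH sclK ipK M N lam"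
    using mem_complementable_iff[OF M N T] by (simp add: M'_def N'_def)
qed

end

theorem theorem4p1:
  fixes sclH :: "'k::real_or_complex \<Rightarrow> 'a::{real_normed_vector, complete_space} \<Rightarrow> 'a"
    and ipH :: "'a \<Rightarrow> 'a \<Rightarrow> 'k"
    and sclK :: "'k \<Rightarrow> 'b::{real_normed_vector, complete_space} \<Rightarrow> 'b"
    and ipK :: "'b \<Rightarrow> 'b \<Rightarrow> 'k"
    and M :: "'a set" and N :: "'b set" and lam :: real
  assumes "hilbert_space sclH ipH" and "hilbert_space sclK ipK"
    and "module.subspace sclH M" and "closed M"
    and "module.subspace sclK N" and "closed N"
    and "lam > 0"
  shows "(top_of_set (bounded_ops sclH sclK)) closure_of (complementable sclH ipH sclK ipK M N lam)
           \<inter> closed_range_D sclH ipH sclK ipK M N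
         \<subseteq> complementable sclH ipH sclK ipK M N lam"
proof -
  interpret hilbert_space_pair sclH ipH sclK ipK
    using assms(1,2) by (rule hilbert_space_pair.intro)
  \<comment> \<open>The relative closure is the trace on \<open>bounded_ops\<close> of a norm
    closure, which here is enlarged by monotonicity to the closure of the whole set of
    complementable operators.\<close>
  have "top_of_set (bounded_ops sclH sclK) closure_of complementable sclH ipH sclK ipK M N lam
      \<subseteq> bounded_ops sclH sclK \<inter> closure (complementable sclH ipH sclK ipK M N lam)"
    by (auto simp: closure_of_subtopology dest: subsetD[OF closure_mono[OF Int_lower2]])
  then show ?thesis
    using closure_complementable_subset[of M N lam] assms(3-7) by blast
qed

end
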